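(* For each $n$ let $\pi$ be a uniformly random permutation in $S_n$. For any function $\omega:\mathbb{N}\to(0,\infty)$ with $\omega(n)\to\infty$ as $n\to\infty$, $$\lim_{n\to\infty}\mathbb{P}\left(c(\pi)\ge\left(1-\frac{\omega(n)}{\sqrt n}\right)n\right)=1,$$ and also $$\lim_{n\to\infty}\mathbb{P}\left(c(\pi)\le\left(1-\frac{1}{\omega(n)\sqrt n}\right)n\right)=1.$$ Consequently, $\mathbb{E}[c(\pi)]=(1-o(1))\,n$ as $n\to\infty$.
   Context: $S_n$ is the set of permutations of $[n]=\{1,\dots,n\}$, with $\pi\in S_n$ written as the sequence $(\pi(1),\dots,\pi(n))$. For indices $1\le i_1<i_2<\cdots<i_k\le n$, the subsequence $S=(\pi(i_1),\dots,\pi(i_k))$ is called caged if $\{\min(S),\max(S)\}=\{\pi(i_1),\pi(i_k)\}$, i.e. the first and last terms of $S$ are its minimum and maximum, in either order. The caged length $c(\pi)$ is the maximum length (number of terms) of a caged subsequence of $\pi$. *)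

theory Defs
  imports
    "HOL-Probability.Probability"
    "HOL-Combinatorics.Permutations"
    "HOL-Library.Sublist"
    "HOL-Library.Landau_Symbols"
begin

abbreviation Sym :: "nat \<Rightarrow> (nat \<Rightarrow> nat) set" where
  "Sym n \<equiv> {\<pi>. \<pi> permutes {1..n}}"

definition one_line :: "nat \<Rightarrow> (nat \<Rightarrow> nat) \<Rightarrow> nat list" where
  "one_line n \<pi> = map \<pi> [1..<Suc n]"

definition caged :: "nat list \<Rightarrow> bool" where
  "caged S \<longleftrightarrow> S \<noteq> [] \<and> {Min (set S), Max (set S)} = {hd S, last S}"

(* For n = 0 there is no caged subsequence and the value is unspecified. *)
definition caged_length :: "nat \<Rightarrow> (nat \<Rightarrow> nat) \<Rightarrow> nat" where
  "caged_length n \<pi> = Max {length S | S. subseq S (one_line n \<pi>) \<and> caged S}"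

definition random_perm :: "nat \<Rightarrow> (nat \<Rightarrow> nat) pmf" where
  "random_perm n = pmf_of_set (Sym n)"

lemma caged_length_bounds:
  assumes "n \<ge> 1"
  shows "caged_length n \<pi> \<in> {1..n}"
proof -
  let ?L = "{length S | S. subseq S (one_line n \<pi>) \<and> caged S}"
  have sub: "?L \<subseteq> {1..n}"
    by (auto simp: caged_def one_line_def Suc_le_eq dest: list_emb_length)
  have "subseq [\<pi> 1] (one_line n \<pi>)"
    unfolding one_line_def subseq_singleton_left set_map
    by (rule imageI) (use assms in auto)
  then have "length [\<pi> 1] \<in> ?L"
    by (force simp: caged_def)
  then have "Max ?L \<in> ?L"
    using sub by (intro Max_in) (auto intro: finite_subset)
  with sub show ?thesis
    unfolding caged_length_def by blast
qed

end

theory Submission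
  imports Defs
begin

text \<open>
  Let $m = n - c(\<pi>)$. If \<open>\<pi>\<close> maps some index below $a$ to a value below $a$ and some index above
  $n - a$ to a value above $n - a$, then the entries lying between these two points, in position
  and in value, form a caged subsequence missing at most $4a$ entries. Conversely, the first entry
  of a longest caged subsequence is a point of the graph of \<open>\<pi>\<close> within distance $m$ of a left-hand
  corner of the square $[n]^2$. A corner box of side $a$ contains $a^2/n$ graph points on average,
  with variance at most its mean, so it is typically empty for $a \<ll> \<surd>n$ (first moment) and
  nonempty for $a \<gg> \<surd>n$ (Chebyshev).
\<close>

section \<open>The law of one or two values of a uniform random permutation\<close>

lemma set_random_perm: "set_pmf (random_perm n) = Sym n"
  unfolding random_perm_def
  by (rule set_pmf_of_set) (auto intro: finite_permutations permutes_id)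

lemma integrable_random_perm [simp]:
  fixes f :: "(nat \<Rightarrow> nat) \<Rightarrow> real"
  shows "integrable (random_perm n) f"
  by (rule integrable_measure_pmf_finite) (auto simp: set_random_perm finite_permutations)

text \<open>Left composition with \<tau> is a bijection of \<open>Sym n\<close>, so it preserves the
  uniform law. This symmetry in the values is what determines the marginals below.\<close>

lemma map_random_perm_comp:
  assumes "\<tau> permutes {1..n}"
  shows "map_pmf ((\<circ>) \<tau>) (random_perm n) = random_perm n"
proof -
  have "inj ((\<circ>) \<tau>)"
    by (intro fun.inj_map permutes_inj[OF assms])
  then have "map_pmf ((\<circ>) \<tau>) (random_perm n) = pmf_of_set ((\<circ>) \<tau> ` Sym n)"
    unfolding random_perm_def
    by (intro map_pmf_of_set_inj)
      (auto intro: finite_permutations permutes_id inj_on_subset)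
  also have "(\<circ>) \<tau> ` Sym n = Sym n"
    using image_compose_permutations_left[OF assms] by (simp add: image_Collect)
  finally show ?thesis
    by (simp only: random_perm_def)
qed

text \<open>A constant mass on a finite set carrying total mass 1 must be \<open>1 / card S\<close>.
  Uniformity thus follows from symmetry alone, with no counting of permutations.\<close>

lemma pmf_eq_pmf_of_setI:
  assumes "finite S" "set_pmf p \<subseteq> S"
    and const: "\<And>x y. x \<in> S \<Longrightarrow> y \<in> S \<Longrightarrow> pmf p x = pmf p y"
  shows "p = pmf_of_set S"
proof -
  have "S \<noteq> {}"
    using assms(2) set_pmf_not_empty[of p] by blast
  have "pmf p x = pmf (pmf_of_set S) x" for x
  proof (cases "x \<in> S")
    case True
    have "1 = sum (pmf p) S"
      using assms(1,2) by (simp add: sum_pmf_eq_1)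
    also have "\<dots> = card S * pmf p x"
      using sum.cong[OF refl const[OF _ True], of S "\<lambda>y. y"] by simp
    finally show ?thesis
      using True \<open>finite S\<close> \<open>S \<noteq> {}\<close> by (auto simp: field_simps)
  next
    case False
    then show ?thesis
      using assms(2) \<open>finite S\<close> \<open>S \<noteq> {}\<close> by (auto simp: set_pmf_iff)
  qed
  then show ?thesis
    by (rule pmf_eqI)
qed

text \<open>Transposing the values \<open>x\<close> and \<open>y\<close> preserves the law and
  exchanges the events \<open>\<pi> i = x\<close> and \<open>\<pi> i = y\<close>, so these are
  equally likely.\<close>

lemma map_random_perm_eval:
  assumes i: "i \<in> {1..n}"
  shows "map_pmf (\<lambda>\<pi>. \<pi> i) (random_perm n) = pmf_of_set {1..n}"
proof (rule pmf_eq_pmf_of_setI)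
  show "set_pmf (map_pmf (\<lambda>\<pi>. \<pi> i) (random_perm n)) \<subseteq> {1..n}"
    using i by (auto simp: set_random_perm simp flip: atLeastAtMost_iff One_nat_def
        dest: permutes_in_image)
next
  fix x y assume xy: "x \<in> {1..n}" "y \<in> {1..n}"
  let ?p = "map_pmf (\<lambda>\<pi>. \<pi> i) (random_perm n)"
  let ?\<tau> = "Transposition.transpose x y"
  have "?p = map_pmf (\<lambda>\<pi>. \<pi> i) (map_pmf ((\<circ>) ?\<tau>) (random_perm n))"
    by (simp only: map_random_perm_comp[OF permutes_swap_id[OF xy]])
  also have "\<dots> = map_pmf ?\<tau> ?p"
    by (simp add: pmf.map_comp o_def)
  finally have "pmf ?p y = pmf (map_pmf ?\<tau> ?p) (?\<tau> x)"
    by simp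
  also have "\<dots> = pmf ?p x"
    by (intro pmf_map_inj' inj_transpose)
  finally show "pmf ?p x = pmf ?p y" ..
qed simp

text \<open>The argument for one value carries over because the symmetric group acts transitively on
  ordered pairs of distinct values.\<close>

lemma map_random_perm_eval2:
  assumes i: "i \<in> {1..n}" and j: "j \<in> {1..n}" and "i \<noteq> j"
  shows "map_pmf (\<lambda>\<pi>. (\<pi> i, \<pi> j)) (random_perm n)
    = pmf_of_set {(x, y) \<in> {1..n} \<times> {1..n}. x \<noteq> y}" (is "?p = pmf_of_set ?S")
proof (rule pmf_eq_pmf_of_setI)
  show "finite ?S"
    by (rule finite_subset[of _ "{1..n} \<times> {1..n}"]) auto
  have "\<pi> i \<in> {1..n}" "\<pi> j \<in> {1..n}" "\<pi> i \<noteq> \<pi> j" if "\<pi> permutes {1..n}" for \<pi>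
    using permutes_in_image[OF that] i j \<open>i \<noteq> j\<close> permutes_inj[OF that]
    by (auto dest: injD)
  then show "set_pmf ?p \<subseteq> ?S"
    by (auto simp: set_random_perm)
next
  fix u v assume "u \<in> ?S" "v \<in> ?S"
  then obtain x y x' y' where uv: "u = (x, y)" "v = (x', y')"
    and *: "x \<in> {1..n}" "y \<in> {1..n}" "x' \<in> {1..n}" "y' \<in> {1..n}" "x \<noteq> y" "x' \<noteq> y'"
    by auto
  \<comment> \<open>The transposition applied first sends \<open>x\<close> to \<open>x'\<close>. The
    second sends the current image of \<open>y\<close> to \<open>y'\<close> and fixes
    \<open>x'\<close>, since \<open>x'\<close> differs from that image and from
    \<open>y'\<close>.\<close>
  define \<tau> where "\<tau> = Transposition.transpose (Transposition.transpose x x' y) y'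
    \<circ> Transposition.transpose x x'"
  have \<tau>: "\<tau> permutes {1..n}"
    unfolding \<tau>_def using *
    by (intro permutes_compose permutes_swap_id) (auto simp: Transposition.transpose_def)
  have \<tau>v: "\<tau> x = x'" "\<tau> y = y'"
    using * by (auto simp: \<tau>_def Transposition.transpose_def)
  have "?p = map_pmf (\<lambda>\<pi>. (\<pi> i, \<pi> j)) (map_pmf ((\<circ>) \<tau>) (random_perm n))"
    by (simp only: map_random_perm_comp[OF \<tau>])
  also have "\<dots> = map_pmf (map_prod \<tau> \<tau>) ?p"
    by (simp add: pmf.map_comp o_def)
  finally have "pmf ?p v = pmf (map_pmf (map_prod \<tau> \<tau>) ?p) (map_prod \<tau> \<tau> u)"
    by (simp add: uv \<tau>v)
  also have "\<dots> = pmf ?p u"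
    using permutes_inj[OF \<tau>] by (intro pmf_map_inj' prod.inj_map)
  finally show "pmf ?p u = pmf ?p v" ..
qed

section \<open>Probability that the graph meets or avoids a box\<close>

lemma prob_random_perm_eval:
  assumes "i \<in> {1..n}" "B \<subseteq> {1..n}"
  shows "measure_pmf.prob (random_perm n) {\<pi>. \<pi> i \<in> B} = card B / n"
proof -
  have "measure_pmf.prob (random_perm n) {\<pi>. \<pi> i \<in> B}
      = measure_pmf.prob (map_pmf (\<lambda>\<pi>. \<pi> i) (random_perm n)) B"
    by (simp add: vimage_def)
  also have "\<dots> = card B / n"
    using assms by (subst map_random_perm_eval) (auto simp: measure_pmf_of_set Int_absorb1)
  finally show ?thesis .
qed

lemma card_off_diagonal:
  assumes "finite B"
  shows "card {(x, y) \<in> B \<times> B. x \<noteq> y} = card B * (card B - 1)"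
proof -
  have "{(x, y) \<in> B \<times> B. x \<noteq> y} = (SIGMA x:B. B - {x})"
    by auto
  then show ?thesis
    using assms by (simp add: card_SigmaI)
qed

text \<open>Two values are drawn without replacement: with \<open>b = card B\<close> the probability
  is b(b-1) / (n(n-1)), and (b-1)/(n-1) \<le> b/n because b \<le> n. This negative correlation keeps
  the variance of the number of graph points in a box below its mean.\<close>

lemma prob_random_perm_eval2:
  assumes i: "i \<in> {1..n}" and j: "j \<in> {1..n}" and "i \<noteq> j" and B: "B \<subseteq> {1..n}"
  shows "measure_pmf.prob (random_perm n) {\<pi>. \<pi> i \<in> B \<and> \<pi> j \<in> B} \<le> (card B / n)\<^sup>2"
proof -
  let ?S = "\<lambda>B :: nat set. {(x, y) \<in> B \<times> B. x \<noteq> y}"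
  have fin: "finite (?S {1..n})"
    by (rule finite_subset[of _ "{1..n} \<times> {1..n}"]) auto
  have ne: "?S {1..n} \<noteq> {}"
    using i j \<open>i \<noteq> j\<close> by blast
  have n2: "n \<ge> 2"
    using i j \<open>i \<noteq> j\<close> by auto
  have b: "card B \<le> n"
    using card_mono[OF _ B] by simp
  have "measure_pmf.prob (random_perm n) {\<pi>. \<pi> i \<in> B \<and> \<pi> j \<in> B}
      = measure_pmf.prob (map_pmf (\<lambda>\<pi>. (\<pi> i, \<pi> j)) (random_perm n)) (B \<times> B)"
    by (simp add: vimage_def)
  also have "\<dots> = card (?S {1..n} \<inter> B \<times> B) / card (?S {1..n})"
    using fin ne by (subst map_random_perm_eval2[OF i j \<open>i \<noteq> j\<close>]) (rule measure_pmf_of_set)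
  also have "?S {1..n} \<inter> B \<times> B = ?S B"
    using B by auto
  also have "card (?S B) / card (?S {1..n}) = (card B * (card B - 1)) / (n * (n - 1))"
    by (simp only: card_off_diagonal finite_subset[OF B finite_atLeastAtMost] finite_atLeastAtMost
        card_atLeastAtMost diff_Suc_1 add_diff_cancel_right')
  also have "\<dots> = (card B / n) * (real (card B - 1) / real (n - 1))"
    by simp
  also have "\<dots> \<le> (card B / n) * (card B / n)"
  proof (rule mult_left_mono)
    show "real (card B - 1) / real (n - 1) \<le> card B / n"
    \<comment> \<open>Natural subtraction truncates at \<open>card B = 0\<close>, where both sides
      vanish; otherwise \<open>card B - 1\<close> is a true difference.\<close>
    proof (cases "card B = 0")
      case False
      with n2 b have "(real (card B) - 1) * n \<le> card B * (real n - 1)"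
        by (simp add: left_diff_distrib right_diff_distrib)
      with False n2 show ?thesis
        by (simp add: of_nat_diff pos_divide_le_eq pos_le_divide_eq)
    qed simp
  qed simp
  finally show ?thesis
    by (simp add: power2_eq_square)
qed

text \<open>Union bound over \<open>A\<close>; the right-hand side is the expected number of graph
  points in \<open>A \<times> B\<close>.\<close>

lemma prob_random_perm_meets_le:
  assumes A: "A \<subseteq> {1..n}" and B: "B \<subseteq> {1..n}"
  shows "measure_pmf.prob (random_perm n) {\<pi>. \<exists>i\<in>A. \<pi> i \<in> B} \<le> card A * card B / n"
proof -
  have finA: "finite A"
    using A finite_subset by blast
  have "measure_pmf.prob (random_perm n) {\<pi>. \<exists>i\<in>A. \<pi> i \<in> B}
      = measure_pmf.prob (random_perm n) (\<Union>i\<in>A. {\<pi>. \<pi> i \<in> B})"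
    by (rule arg_cong[where f = "measure_pmf.prob (random_perm n)"]) auto
  also have "\<dots> \<le> (\<Sum>i\<in>A. measure_pmf.prob (random_perm n) {\<pi>. \<pi> i \<in> B})"
    using finA by (intro measure_pmf.finite_measure_subadditive_finite) auto
  also have "\<dots> = (\<Sum>i\<in>A. card B / n)"
    using A B by (intro sum.cong refl prob_random_perm_eval) auto
  finally show ?thesis
    by simp
qed

text \<open>Second moment method: the number \<open>X\<close> of graph points in
  \<open>A \<times> B\<close> has mean \<mu> and variance at most \<mu>, so Chebyshev bounds the
  probability of \<open>X = 0\<close> by 1/\<mu>.\<close>

lemma prob_random_perm_avoids_le:
  assumes A: "A \<subseteq> {1..n}" "A \<noteq> {}" and B: "B \<subseteq> {1..n}" "B \<noteq> {}"
  shows "measure_pmf.prob (random_perm n) {\<pi>. \<forall>i\<in>A. \<pi> i \<notin> B} \<le> n / (card A * card B)"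
proof -
  let ?M = "measure_pmf (random_perm n)"
  let ?P = "measure_pmf.prob (random_perm n)"
  let ?E = "measure_pmf.expectation (random_perm n)"
  let ?I = "\<lambda>i. indicat_real {\<pi>. \<pi> i \<in> B}"
  have fin: "finite A" "finite B"
    using A B finite_subset by blast+
  define \<mu> where "\<mu> = card A * card B / n"
  define X where "X = (\<lambda>\<pi>. \<Sum>i\<in>A. ?I i \<pi>)"
  have "card A > 0" "card B > 0" "n > 0"
    using A B fin by (auto simp: card_gt_0_iff)
  then have pos: "\<mu> > 0"
    by (simp add: \<mu>_def)
  have EX: "?E X = \<mu>"
  proof -
    have "?E X = (\<Sum>i\<in>A. ?P {\<pi>. \<pi> i \<in> B})"
      unfolding X_def by (subst Bochner_Integration.integral_sum) auto
    also have "\<dots> = (\<Sum>i\<in>A. card B / n)"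
      using A B by (intro sum.cong refl prob_random_perm_eval) auto
    finally show ?thesis
      by (simp add: \<mu>_def)
  qed
  have "?E (\<lambda>\<pi>. (X \<pi>)\<^sup>2) = ?E (\<lambda>\<pi>. \<Sum>i\<in>A. \<Sum>j\<in>A. indicat_real {\<pi>. \<pi> i \<in> B \<and> \<pi> j \<in> B} \<pi>)"
    by (intro Bochner_Integration.integral_cong refl)
      (auto simp: X_def power2_eq_square sum_product indicator_def intro!: sum.cong)
  also have "\<dots> = (\<Sum>i\<in>A. \<Sum>j\<in>A. ?P {\<pi>. \<pi> i \<in> B \<and> \<pi> j \<in> B})"
    by (simp add: Bochner_Integration.integral_sum)
  \<comment> \<open>Off-diagonal pairs obey the product bound. A diagonal pair has probability
    \<open>card B / n\<close>; keeping the square there as well makes the sum exactly \<mu> squared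
    plus \<mu>.\<close>
  also have "\<dots> \<le> (\<Sum>i\<in>A. \<Sum>j\<in>A. (card B / n)\<^sup>2 + (if i = j then card B / n else 0))"
  proof (intro sum_mono)
    fix i j assume "i \<in> A" "j \<in> A"
    with A have "i \<in> {1..n}" "j \<in> {1..n}"
      by auto
    then show "?P {\<pi>. \<pi> i \<in> B \<and> \<pi> j \<in> B} \<le> (card B / n)\<^sup>2 + (if i = j then card B / n else 0)"
      using prob_random_perm_eval[of i n B] prob_random_perm_eval2[of i n j B] B by (cases "i = j") simp_all
  qed
  also have "\<dots> = \<mu>\<^sup>2 + \<mu>"
    using fin by (simp add: sum.distrib \<mu>_def power2_eq_square field_simps)
  finally have "measure_pmf.variance (random_perm n) X \<le> \<mu>"
    by (subst measure_pmf.variance_eq) (simp_all add: EX)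
  moreover have "?P {\<pi>. \<forall>i\<in>A. \<pi> i \<notin> B} \<le> ?P {\<pi> \<in> space ?M. \<bar>X \<pi> - ?E X\<bar> \<ge> \<mu>}"
  proof (rule measure_pmf.finite_measure_mono)
    have "X \<pi> = 0" if "\<forall>i\<in>A. \<pi> i \<notin> B" for \<pi>
      using that by (simp add: X_def)
    then show "{\<pi>. \<forall>i\<in>A. \<pi> i \<notin> B} \<subseteq> {\<pi> \<in> space ?M. \<bar>X \<pi> - ?E X\<bar> \<ge> \<mu>}"
      using pos by (auto simp: EX)
  qed simp
  moreover have "?P {\<pi> \<in> space ?M. \<bar>X \<pi> - ?E X\<bar> \<ge> \<mu>} \<le> measure_pmf.variance (random_perm n) X / \<mu>\<^sup>2"
    by (rule measure_pmf.Chebyshev_inequality) (use pos in auto)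
  ultimately have "?P {\<pi>. \<forall>i\<in>A. \<pi> i \<notin> B} \<le> \<mu> / \<mu>\<^sup>2"
    by (smt (verit) divide_right_mono zero_le_power2)
  also have "\<dots> = n / (card A * card B)"
    using pos by (simp add: \<mu>_def power2_eq_square)
  finally show ?thesis .
qed

section \<open>Caged subsequences and the corners of the square\<close>

lemma caged_length_ge:
  assumes S: "subseq S (one_line n \<pi>)" "caged S"
  shows "length S \<le> caged_length n \<pi>"
proof -
  have "{length S | S. subseq S (one_line n \<pi>) \<and> caged S} \<subseteq> {..n}"
    by (auto simp: one_line_def dest: list_emb_length)
  then have "finite {length S | S. subseq S (one_line n \<pi>) \<and> caged S}"
    using finite_subset by blast
  then show ?thesis
    unfolding caged_length_def using S by (intro Max_ge) auto
qed

text \<open>The maximum is over a finite set of lengths, nonempty because the singleton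
  \<open>[\<pi> 1]\<close> is caged.\<close>

lemma caged_length_attained:
  assumes "n \<ge> 1"
  obtains S where "subseq S (one_line n \<pi>)" "caged S" "length S = caged_length n \<pi>"
proof -
  let ?L = "{length S | S. subseq S (one_line n \<pi>) \<and> caged S}"
  have "?L \<subseteq> {..n}"
    by (auto simp: one_line_def dest: list_emb_length)
  then have "finite ?L"
    using finite_subset by blast
  moreover have "subseq [\<pi> 1] (one_line n \<pi>)"
    unfolding one_line_def subseq_singleton_left set_map
    by (rule imageI) (use assms in auto)
  then have "length [\<pi> 1] \<in> ?L"
    by (force simp: caged_def)
  ultimately have "Max ?L \<in> ?L"
    by (intro Max_in) auto
  then show ?thesis
    using that unfolding caged_length_def by auto
qed

text \<open>The positions in \<open>{i..j}\<close> with values in \<open>{\<pi> i..\<pi> j}\<close>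
  give a caged subsequence. A lost entry has its position or its value in one of the two outer
  strips of width \<open>a\<close>, which leaves at most \<open>4 * a\<close> losses.\<close>

lemma caged_length_ge_corners:
  assumes \<pi>: "\<pi> permutes {1..n}" and a: "2 * a \<le> n"
    and i: "i \<in> {1..a}" "\<pi> i \<in> {1..a}"
    and j: "j \<in> {n + 1 - a..n}" "\<pi> j \<in> {n + 1 - a..n}"
  shows "n \<le> caged_length n \<pi> + 4 * a"
proof -
  \<comment> \<open>Since \<open>2 * a \<le> n\<close>, the low strip lies strictly below the high
    one.\<close>
  have ij: "i < j" "\<pi> i < \<pi> j"
    using a i j by auto
  define ks where "ks = filter (\<lambda>k. \<pi> k \<in> {\<pi> i..\<pi> j}) [i..<Suc j]"
  have ks: "set ks = {k \<in> {i..j}. \<pi> k \<in> {\<pi> i..\<pi> j}}"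
    by (auto simp: ks_def)
  \<comment> \<open>Both endpoints survive the filter, so the first and last entries of the
    subsequence are \<open>\<pi> i\<close> and \<open>\<pi> j\<close>.\<close>
  have ks_eq: "ks = i # filter (\<lambda>k. \<pi> k \<in> {\<pi> i..\<pi> j}) [Suc i..<j] @ [j]"
    using ij by (simp add: ks_def upt_conv_Cons)
  have "subseq [i..<Suc j] [1..<Suc n]"
  proof -
    have "[1..<Suc n] = [1..<i] @ [i..<Suc j] @ [Suc j..<Suc n]"
      using i j ij upt_add_eq_append[of 1 i "Suc n - i"] upt_add_eq_append[of i "Suc j" "n - j"]
      by (auto simp del: upt_Suc)
    then show ?thesis
      by (metis sublist_appendI sublist_imp_subseq)
  qed
  then have "subseq (map \<pi> ks) (one_line n \<pi>)"
    unfolding one_line_def ks_def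
    by (meson subseq_filter_left subseq_map subseq_order.trans)
  moreover have "caged (map \<pi> ks)"
  proof -
    have "Min (set (map \<pi> ks)) = \<pi> i" "Max (set (map \<pi> ks)) = \<pi> j"
      using ij unfolding set_map ks by (auto intro!: Min_eqI Max_eqI)
    then show ?thesis
      by (simp add: caged_def ks_eq)
  qed
  ultimately have "length (map \<pi> ks) \<le> caged_length n \<pi>"
    by (rule caged_length_ge)
  moreover have "length ks = card (set ks)"
    unfolding ks_def by (intro distinct_card[symmetric] distinct_filter distinct_upt)
  moreover have "n \<le> card (set ks) + 4 * a"
  proof -
    let ?L = "{1..a}" and ?R = "{n + 1 - a..n}"
    \<comment> \<open>A number outside both strips lies above everything in \<open>?L\<close> and
      below everything in \<open>?R\<close>. For the position this puts \<open>k\<close> between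
      \<open>i\<close> and \<open>j\<close>, and for the value it puts \<open>\<pi> k\<close>
      between \<open>\<pi> i\<close> and \<open>\<pi> j\<close>.\<close>
    have "k \<in> set ks \<union> (?L \<union> ?R) \<union> (\<pi> -` ?L \<union> \<pi> -` ?R)" if "k \<in> {1..n}" for k
      using that permutes_in_image[OF \<pi>, of k] i j by (auto simp: ks)
    then have "{1..n} \<subseteq> set ks \<union> (?L \<union> ?R) \<union> (\<pi> -` ?L \<union> \<pi> -` ?R)"
      by blast
    moreover have inj: "inj \<pi>"
      by (rule permutes_inj[OF \<pi>])
    ultimately have "card {1..n} \<le> card (set ks \<union> (?L \<union> ?R) \<union> (\<pi> -` ?L \<union> \<pi> -` ?R))"
      by (intro card_mono) (auto intro: finite_vimageI)
    also have "\<dots> \<le> card (set ks) + (card ?L + card ?R) + (card (\<pi> -` ?L) + card (\<pi> -` ?R))"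
      by (meson add_le_mono card_Un_le le_refl order.trans)
    \<comment> \<open>By bijectivity, a strip of values accounts for as many entries as a strip of
      positions.\<close>
    also have "card (\<pi> -` ?L) = card ?L"
      using permutes_surj[OF \<pi>] inj by (simp add: card_vimage_inj)
    also have "card (\<pi> -` ?R) = card ?R"
      using permutes_surj[OF \<pi>] inj by (intro card_vimage_inj) auto
    finally show ?thesis
      using a by simp
  qed
  ultimately show ?thesis
    by simp
qed

text \<open>The point is the first entry of a longest caged subsequence. All its positions are at
  least \<open>i\<close>; all its values are at least \<open>\<pi> i\<close> if the first entry is
  the minimum, and at most \<open>\<pi> i\<close> if it is the maximum. Counting the available
  positions and values gives the bounds.\<close>

lemma caged_length_imp_corner:
  assumes \<pi>: "\<pi> permutes {1..n}" and n: "n \<ge> 1"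
  obtains i where "i \<in> {1..n}" "i \<le> n + 1 - caged_length n \<pi>"
    "\<pi> i \<le> n + 1 - caged_length n \<pi> \<or> \<pi> i \<ge> caged_length n \<pi>"
proof -
  obtain S where S: "subseq S (one_line n \<pi>)" "caged S" "length S = caged_length n \<pi>"
    using caged_length_attained[OF n] .
  \<comment> \<open>The subsequence is pulled back to its increasing list \<open>ks\<close> of
    positions, as selecting indices commutes with \<open>map \<pi>\<close>.\<close>
  then obtain N where "S = nths (map \<pi> [1..<Suc n]) N"
    by (auto simp: subseq_conv_nths one_line_def)
  then obtain ks where Sks: "S = map \<pi> ks" and ks: "ks = nths [1..<Suc n] N"
    by (simp only: nths_map)
  have sorted: "sorted ks" and dist: "distinct ks" and sub: "set ks \<subseteq> {1..n}"
    unfolding ks by (auto intro: sorted_nths distinct_nthsI dest: in_set_nthsD simp del: upt_Suc)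
  have "ks \<noteq> []"
    using S(2) by (auto simp: caged_def Sks)
  then obtain i ks' where i: "ks = i # ks'"
    by (cases ks) auto
  \<comment> \<open>Entries of \<open>S\<close> are distinct because \<pi> is injective, so any
    finite set containing them bounds the length.\<close>
  have bound: "caged_length n \<pi> \<le> card T" if "set S \<subseteq> T" "finite T" for T
  proof -
    have "distinct S"
      using dist inj_on_subset[OF permutes_inj[OF \<pi>]] by (simp add: Sks distinct_map)
    then show ?thesis
      using card_mono[OF that(2,1)] by (simp add: distinct_card S(3))
  qed
  have range: "set S \<subseteq> {1..n}"
    using sub permutes_in_image[OF \<pi>] by (auto simp: Sks)
  show ?thesis
  proof
    show "i \<in> {1..n}"
      using sub i by simp
    have "set ks \<subseteq> {i..n}"
      using sorted sub i by auto
    then have "card (set ks) \<le> card {i..n}"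
      by (intro card_mono) auto
    then have "length S \<le> n + 1 - i"
      using dist by (simp add: distinct_card Sks)
    then show "i \<le> n + 1 - caged_length n \<pi>"
      using \<open>i \<in> {1..n}\<close> S(3) by auto
    have hd: "hd S = \<pi> i"
      by (simp add: Sks i)
    have pi: "\<pi> i \<in> {1..n}"
      using range by (simp add: Sks i)
    have "hd S = Min (set S) \<or> hd S = Max (set S)"
      using S(2) by (auto simp: caged_def doubleton_eq_iff)
    then show "\<pi> i \<le> n + 1 - caged_length n \<pi> \<or> \<pi> i \<ge> caged_length n \<pi>"
    proof
      assume "hd S = Min (set S)"
      then have "set S \<subseteq> {\<pi> i..n}"
        using range by (auto simp: hd[symmetric])
      then show ?thesis
        using bound[of "{\<pi> i..n}"] pi by auto
    next
      assume "hd S = Max (set S)"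
      then have "set S \<subseteq> {1..\<pi> i}"
        using range by (auto simp: hd[symmetric])
      then show ?thesis
        using bound[of "{1..\<pi> i}"] pi by auto
    qed
  qed
qed

section \<open>Explicit tail bounds for fixed n\<close>

text \<open>Events are sets of arbitrary functions, but the mass sits on \<open>Sym n\<close>, so an
  implication between events has to be checked for permutations only.\<close>

lemma prob_random_perm_mono:
  assumes "\<And>\<pi>. \<pi> permutes {1..n} \<Longrightarrow> P \<pi> \<Longrightarrow> Q \<pi>"
  shows "measure_pmf.prob (random_perm n) {\<pi>. P \<pi>} \<le> measure_pmf.prob (random_perm n) {\<pi>. Q \<pi>}"
  by (rule measure_pmf.finite_measure_mono_AE) (auto simp: AE_measure_pmf_iff set_random_perm assms)

lemma prob_pmf_neg: "measure_pmf.prob p {x. P x} = 1 - measure_pmf.prob p {x. \<not> P x}"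
  using measure_pmf.prob_neg[where M = p and P = "\<lambda>x. \<not> P x"] by simp

text \<open>The event allows a loss of \<open>t * sqrt n\<close>, which pays for corner boxes of
  side about a quarter of that. Each of the two boxes is empty with probability at most
  \<open>64 / t\<^sup>2\<close>.\<close>

lemma prob_caged_length_ge:
  assumes t: "t > 0" "t * sqrt n \<ge> 8"
  shows "measure_pmf.prob (random_perm n)
    {\<pi>. real (caged_length n \<pi>) \<ge> (1 - t / sqrt n) * n} \<ge> 1 - 128 / t\<^sup>2"
proof (cases "t \<ge> sqrt n")
  \<comment> \<open>Here the threshold is at most 0, so the event is certain.\<close>
  case True
  have "n > 0"
    using t by (cases n) auto
  then have "(1 - t / sqrt n) * n \<le> 0"
    using True by (intro mult_nonpos_nonneg) auto
  then have "{\<pi>. real (caged_length n \<pi>) \<ge> (1 - t / sqrt n) * n} = UNIV"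
    by (smt (verit) Collect_cong UNIV_def of_nat_0_le_iff)
  then show ?thesis
    by simp
next
  case False
  let ?P = "measure_pmf.prob (random_perm n)"
  have n: "n > 0"
    using t by (cases n) auto
  \<comment> \<open>Rounding down keeps \<open>4 * a\<close> within the allowed loss. As
    \<open>t * sqrt n / 4\<close> is at least 2, rounding loses at most half of it, whence the lower
    bound with 8.\<close>
  define a where "a = nat \<lfloor>t * sqrt n / 4\<rfloor>"
  have a_le: "a \<le> t * sqrt n / 4" and a_ge: "a \<ge> t * sqrt n / 8"
    unfolding a_def using t by linarith+
  have "t * sqrt n \<le> sqrt n * sqrt n"
    using False by (intro mult_right_mono) auto
  then have "real (4 * a) \<le> real n"
    using a_le by simp
  then have a: "2 * a \<le> n"
    by linarith
  have a0: "a > 0"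
    using a_ge t by (cases a) auto
  let ?L = "{1..a}" and ?R = "{n + 1 - a..n}"
  have card: "card ?L = a" "card ?R = a"
    using a by auto
  have avoid: "?P {\<pi>. \<forall>i\<in>A. \<pi> i \<notin> A} \<le> 64 / t\<^sup>2" if "A \<in> {?L, ?R}" for A
  proof -
    have "?P {\<pi>. \<forall>i\<in>A. \<pi> i \<notin> A} \<le> n / (real (card A) * card A)"
      using prob_random_perm_avoids_le[of A n A] that a a0 by auto
    also have "\<dots> = n / (real a * a)"
      using that card by auto
    also have "\<dots> \<le> n / ((t * sqrt n / 8) * (t * sqrt n / 8))"
      using a_ge t n by (intro divide_left_mono mult_mono mult_pos_pos) auto
    also have "\<dots> = 64 / t\<^sup>2"
      using t n by (simp add: field_simps power2_eq_square)
    finally show ?thesis .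
  qed
  have "?P {\<pi>. \<not> real (caged_length n \<pi>) \<ge> (1 - t / sqrt n) * n}
      \<le> ?P {\<pi>. (\<forall>i\<in>?L. \<pi> i \<notin> ?L) \<or> (\<forall>i\<in>?R. \<pi> i \<notin> ?R)}"
  proof (rule prob_random_perm_mono, rule ccontr)
    fix \<pi> assume \<pi>: "\<pi> permutes {1..n}"
      and less: "\<not> real (caged_length n \<pi>) \<ge> (1 - t / sqrt n) * n"
      and "\<not> ((\<forall>i\<in>?L. \<pi> i \<notin> ?L) \<or> (\<forall>i\<in>?R. \<pi> i \<notin> ?R))"
    then have "n \<le> caged_length n \<pi> + 4 * a"
      using caged_length_ge_corners[OF \<pi> a] by blast
    then have "real n \<le> caged_length n \<pi> + 4 * a"
      by linarith
    moreover have "(1 - t / sqrt n) * n = n - t * sqrt n"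
      using n by (simp add: field_simps)
    ultimately show False
      using less a_le by linarith
  qed
  also have "\<dots> \<le> ?P {\<pi>. \<forall>i\<in>?L. \<pi> i \<notin> ?L} + ?P {\<pi>. \<forall>i\<in>?R. \<pi> i \<notin> ?R}"
    unfolding Collect_disj_eq by (rule measure_Un_le) auto
  also have "\<dots> \<le> 64 / t\<^sup>2 + 64 / t\<^sup>2"
    by (intro add_mono avoid) auto
  finally show ?thesis
    by (subst prob_pmf_neg) simp
qed

text \<open>If the loss is below \<open>sqrt n / t\<close>, the graph meets one of the two left-hand
  corner boxes of side \<open>k\<close>, which contain at most \<open>2 * k\<^sup>2 / n\<close>
  points on average. Rounding \<open>sqrt n / t\<close> up to \<open>k\<close> produces the term
  \<open>1 / sqrt n\<close>.\<close>

lemma prob_caged_length_le: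
  assumes t: "t > 0" and n: "n > 0"
  shows "measure_pmf.prob (random_perm n)
    {\<pi>. real (caged_length n \<pi>) \<le> (1 - 1 / (t * sqrt n)) * n} \<ge> 1 - 2 * (1 / t + 1 / sqrt n)\<^sup>2"
proof -
  let ?P = "measure_pmf.prob (random_perm n)"
  define k where "k = nat \<lceil>sqrt n / t\<rceil>"
  have k_ge: "real k \<ge> sqrt n / t"
    unfolding k_def by linarith
  have "sqrt n / t \<ge> 0"
    using t by simp
  then have k_le: "real k \<le> sqrt n / t + 1"
    unfolding k_def by linarith
  \<comment> \<open>For small \<open>t\<close> the side \<open>k\<close> may exceed
    \<open>n\<close>, so the box is cut down to the square.\<close>
  define A where "A = {1..n} \<inter> {1..k}"
  define B where "B = {1..n} \<inter> ({1..k} \<union> {n + 1 - k..n})"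
  have cA: "card A \<le> k"
    unfolding A_def using card_mono[of "{1..k}" "{1..n} \<inter> {1..k}"] by simp
  have cB: "card B \<le> 2 * k"
  proof -
    have "card B \<le> card ({1..k} \<union> {n + 1 - k..n})"
      unfolding B_def by (intro card_mono) auto
    also have "\<dots> \<le> card {1..k} + card {n + 1 - k..n}"
      by (rule card_Un_le)
    also have "\<dots> \<le> 2 * k"
      by simp
    finally show ?thesis .
  qed
  have "?P {\<pi>. \<not> real (caged_length n \<pi>) \<le> (1 - 1 / (t * sqrt n)) * n} \<le> ?P {\<pi>. \<exists>i\<in>A. \<pi> i \<in> B}"
  proof (rule prob_random_perm_mono)
    fix \<pi> assume \<pi>: "\<pi> permutes {1..n}"
      and gr: "\<not> real (caged_length n \<pi>) \<le> (1 - 1 / (t * sqrt n)) * n"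
    obtain i where i: "i \<in> {1..n}" "i \<le> n + 1 - caged_length n \<pi>"
      "\<pi> i \<le> n + 1 - caged_length n \<pi> \<or> \<pi> i \<ge> caged_length n \<pi>"
      using caged_length_imp_corner[OF \<pi>] n by auto
    have "(1 - 1 / (t * sqrt n)) * n = n - n / sqrt n / t"
      by (simp add: left_diff_distrib)
    also have "n / sqrt n = sqrt n"
      by (simp add: real_div_sqrt)
    finally have "(1 - 1 / (t * sqrt n)) * n = n - sqrt n / t" .
    then have "real n < caged_length n \<pi> + k"
      using gr k_ge by linarith
    \<comment> \<open>Strictness between integers supplies the 1 that makes
      \<open>n + 1 - caged_length n \<pi>\<close> at most \<open>k\<close>, matching the corner
      lemma.\<close>
    then have "n + 1 \<le> caged_length n \<pi> + k"
      by linarith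
    then have "i \<in> A" "\<pi> i \<in> B"
      using i permutes_in_image[OF \<pi>, of i] by (auto simp: A_def B_def)
    then show "\<exists>i\<in>A. \<pi> i \<in> B" ..
  qed
  also have "\<dots> \<le> card A * card B / n"
    by (rule prob_random_perm_meets_le) (auto simp: A_def B_def)
  also have "\<dots> \<le> real k * real (2 * k) / n"
    using mult_le_mono[OF cA cB] by (simp flip: of_nat_mult add: divide_right_mono)
  also have "\<dots> = 2 * (k / sqrt n)\<^sup>2"
    by (simp add: power_divide) (simp add: power2_eq_square)
  also have "\<dots> \<le> 2 * ((sqrt n / t + 1) / sqrt n)\<^sup>2"
    using k_le by (intro mult_left_mono power_mono divide_right_mono) auto
  also have "(sqrt n / t + 1) / sqrt n = 1 / t + 1 / sqrt n"
    using n t by (simp add: field_simps)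
  finally show ?thesis
    by (subst prob_pmf_neg) simp
qed

section \<open>Limits of the probabilities and of the normalised expectation\<close>

text \<open>The fixed-n bound applies with \<open>t = \<omega> n\<close> once
  \<open>\<omega> n \<ge> 8\<close> and \<open>n > 0\<close>, and its error
  \<open>128 / (\<omega> n)\<^sup>2\<close> vanishes.\<close>

lemma prob_caged_length_ge_tendsto:
  fixes \<omega> :: "nat \<Rightarrow> real"
  assumes \<omega>: "filterlim \<omega> at_top sequentially"
  shows "(\<lambda>n. measure_pmf.prob (random_perm n)
    {\<pi>. real (caged_length n \<pi>) \<ge> (1 - \<omega> n / sqrt (real n)) * real n}) \<longlonglongrightarrow> 1"
proof (rule tendsto_sandwich[where h = "\<lambda>_. 1"])
  have "\<forall>\<^sub>F n in sequentially. \<omega> n \<ge> 8"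
    using \<omega> by (simp add: filterlim_at_top)
  then show "\<forall>\<^sub>F n in sequentially. 1 - 128 / (\<omega> n)\<^sup>2 \<le> measure_pmf.prob (random_perm n)
      {\<pi>. real (caged_length n \<pi>) \<ge> (1 - \<omega> n / sqrt (real n)) * real n}"
    using eventually_gt_at_top[of 0]
  proof eventually_elim
    case (elim n)
    then have "8 * 1 \<le> \<omega> n * sqrt n"
      by (intro mult_mono) auto
    then show ?case
      using elim by (intro prob_caged_length_ge) auto
  qed
  have "(\<lambda>n. 128 / (\<omega> n)\<^sup>2) \<longlonglongrightarrow> 0"
    using \<omega> by (intro tendsto_divide_0[OF tendsto_const] filterlim_at_top_imp_at_infinity
        filterlim_pow_at_top) auto
  from tendsto_diff[OF tendsto_const this, of 1] show "(\<lambda>n. 1 - 128 / (\<omega> n)\<^sup>2) \<longlonglongrightarrow> 1"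
    by simp
qed (auto intro: always_eventually)

lemma prob_caged_length_le_tendsto:
  fixes \<omega> :: "nat \<Rightarrow> real"
  assumes \<omega>: "filterlim \<omega> at_top sequentially"
  shows "(\<lambda>n. measure_pmf.prob (random_perm n)
    {\<pi>. real (caged_length n \<pi>) \<le> (1 - 1 / (\<omega> n * sqrt (real n))) * real n}) \<longlonglongrightarrow> 1"
proof (rule tendsto_sandwich[where h = "\<lambda>_. 1"])
  have "\<forall>\<^sub>F n in sequentially. \<omega> n > 0"
    using \<omega> by (simp add: filterlim_at_top_dense)
  then show "\<forall>\<^sub>F n in sequentially. 1 - 2 * (1 / \<omega> n + 1 / sqrt n)\<^sup>2 \<le> measure_pmf.prob (random_perm n)
      {\<pi>. real (caged_length n \<pi>) \<le> (1 - 1 / (\<omega> n * sqrt (real n))) * real n}"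
    using eventually_gt_at_top[of 0]
    by eventually_elim (rule prob_caged_length_le)
  have "filterlim (\<lambda>n. sqrt (real n)) at_top sequentially"
    by (rule filterlim_compose[OF sqrt_at_top filterlim_real_sequentially])
  then have "(\<lambda>n. 1 / \<omega> n + 1 / sqrt n) \<longlonglongrightarrow> 0 + 0"
    using \<omega> by (intro tendsto_add tendsto_divide_0[OF tendsto_const] filterlim_at_top_imp_at_infinity)
  then have "(\<lambda>n. 1 - 2 * (1 / \<omega> n + 1 / sqrt n)\<^sup>2) \<longlonglongrightarrow> 1 - 2 * (0 + 0)\<^sup>2"
    by (intro tendsto_diff tendsto_mult tendsto_power tendsto_const)
  then show "(\<lambda>n. 1 - 2 * (1 / \<omega> n + 1 / sqrt n)\<^sup>2) \<longlonglongrightarrow> 1"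
    by simp
qed (auto intro: always_eventually)

text \<open>The upper bound is \<open>caged_length n \<pi> \<le> n\<close>. The lower bound is of
  Markov type: the likely event that the caged length is at least (1 - 1/\<omega>) n already
  contributes almost n.\<close>

lemma expectation_caged_length_tendsto:
  "(\<lambda>n. measure_pmf.expectation (random_perm n) (\<lambda>\<pi>. real (caged_length n \<pi>)) / n) \<longlonglongrightarrow> 1"
proof (rule tendsto_sandwich[where h = "\<lambda>_. 1"])
  \<comment> \<open>any rate that tends to infinity but is \<open>o(\<surd>n)\<close> would do\<close>
  define \<omega> where "\<omega> = (\<lambda>n. sqrt (sqrt (real n)))"
  let ?p = "\<lambda>n. measure_pmf.prob (random_perm n)
    {\<pi>. real (caged_length n \<pi>) \<ge> (1 - \<omega> n / sqrt (real n)) * real n}"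
  have \<omega>: "filterlim \<omega> at_top sequentially"
    unfolding \<omega>_def
    by (intro filterlim_compose[OF sqrt_at_top] filterlim_real_sequentially)
  show "\<forall>\<^sub>F n in sequentially. (1 - 1 / \<omega> n) * ?p n
      \<le> measure_pmf.expectation (random_perm n) (\<lambda>\<pi>. real (caged_length n \<pi>)) / n"
    using eventually_gt_at_top[of 0]
  proof eventually_elim
    case (elim n)
    \<comment> \<open>By the choice of the rate, \<open>sqrt n\<close> is the square of
      \<open>\<omega> n\<close>.\<close>
    have eq: "\<omega> n / sqrt n = 1 / \<omega> n"
      using elim by (simp add: \<omega>_def field_simps)
    let ?A = "{\<pi>. real (caged_length n \<pi>) \<ge> (1 - \<omega> n / sqrt (real n)) * real n}"
    have "(1 - 1 / \<omega> n) * n * ?p n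
        = measure_pmf.expectation (random_perm n) (\<lambda>\<pi>. (1 - 1 / \<omega> n) * n * indicat_real ?A \<pi>)"
      by simp
    also have "\<dots> \<le> measure_pmf.expectation (random_perm n) (\<lambda>\<pi>. real (caged_length n \<pi>))"
      \<comment> \<open>On \<open>?A\<close> the comparison is the defining inequality; off
        \<open>?A\<close> the smaller integrand is 0.\<close>
      unfolding eq
      by (intro integral_mono) (auto simp: indicator_def)
    finally show ?case
      using elim by (simp add: field_simps)
  qed
  have "(\<lambda>n. 1 / \<omega> n) \<longlonglongrightarrow> 0"
    using \<omega> by (intro tendsto_divide_0[OF tendsto_const] filterlim_at_top_imp_at_infinity)
  then have "(\<lambda>n. (1 - 1 / \<omega> n) * ?p n) \<longlonglongrightarrow> (1 - 0) * 1"
    by (intro tendsto_intros prob_caged_length_ge_tendsto \<omega>)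
  then show "(\<lambda>n. (1 - 1 / \<omega> n) * ?p n) \<longlonglongrightarrow> 1"
    by simp
  show "\<forall>\<^sub>F n in sequentially.
      measure_pmf.expectation (random_perm n) (\<lambda>\<pi>. real (caged_length n \<pi>)) / n \<le> 1"
    using eventually_gt_at_top[of 0]
  proof eventually_elim
    case (elim n)
    have "measure_pmf.expectation (random_perm n) (\<lambda>\<pi>. real (caged_length n \<pi>))
        \<le> measure_pmf.expectation (random_perm n) (\<lambda>_. real n)"
      using caged_length_bounds[of n] elim by (intro integral_mono) auto
    then show ?case
      using elim by simp
  qed
qed simp

theorem theorem1p3:
  shows "(\<forall>\<omega> :: nat \<Rightarrow> real.
            (\<forall>n. \<omega> n > 0) \<and> filterlim \<omega> at_top sequentially \<longrightarrow>
            ((\<lambda>n. measure_pmf.prob (random_perm n)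
                    {\<pi>. real (caged_length n \<pi>) \<ge> (1 - \<omega> n / sqrt (real n)) * real n})
               \<longlonglongrightarrow> 1) \<and>
            ((\<lambda>n. measure_pmf.prob (random_perm n)
                    {\<pi>. real (caged_length n \<pi>) \<le> (1 - 1 / (\<omega> n * sqrt (real n))) * real n})
               \<longlonglongrightarrow> 1)) \<and>
         (\<exists>\<epsilon> :: nat \<Rightarrow> real. \<epsilon> \<in> o(\<lambda>_. 1) \<and>
            (\<forall>n\<ge>1. measure_pmf.expectation (random_perm n) (\<lambda>\<pi>. real (caged_length n \<pi>))
                     = (1 - \<epsilon> n) * real n))"
proof (intro conjI)
  \<comment> \<open>The required identity, solved for \<open>\<epsilon> n\<close>; it can be
    inverted for \<open>n \<ge> 1\<close>.\<close>
  define \<epsilon> where "\<epsilon> = (\<lambda>n.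
    1 - measure_pmf.expectation (random_perm n) (\<lambda>\<pi>. real (caged_length n \<pi>)) / real n)"
  have "\<epsilon> \<longlonglongrightarrow> 0"
    unfolding \<epsilon>_def
    using tendsto_diff[OF tendsto_const expectation_caged_length_tendsto, of 1] by simp
  then have "\<epsilon> \<in> o(\<lambda>_. 1)"
    by (intro smalloI_tendsto) auto
  moreover have "measure_pmf.expectation (random_perm n) (\<lambda>\<pi>. real (caged_length n \<pi>))
      = (1 - \<epsilon> n) * real n" if "n \<ge> 1" for n
    using that by (simp add: \<epsilon>_def)
  ultimately show "\<exists>\<epsilon> :: nat \<Rightarrow> real. \<epsilon> \<in> o(\<lambda>_. 1) \<and>
      (\<forall>n\<ge>1. measure_pmf.expectation (random_perm n) (\<lambda>\<pi>. real (caged_length n \<pi>))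
               = (1 - \<epsilon> n) * real n)"
    by blast
qed (blast intro: prob_caged_length_ge_tendsto prob_caged_length_le_tendsto)

end
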